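(* Let $0<p,q<1$ and $\varepsilon_m=m^{-p}$ for integers $m\ge 2$. For each $m$ let $\pi_{1},\dots,\pi_{m}\in(0,1]$ (possibly depending on $m$), and consider testing $H_0$ against $H_1^{(\mathrm{mix})}$ (defined in the context) from the observations $\zeta_1,\dots,\zeta_m$. (1) If $q+2p<1$ and, for every $m$, $\pi_t\le 1-m^{-q}$ for all $t=1,\dots,m$, then $H_0$ and $H_1^{(\mathrm{mix})}$ separate asymptotically as $m\to\infty$. Furthermore, the alternative is reliably detected by the likelihood ratio test: the sum of its type I and type II error probabilities tends to $0$ as $m\to\infty$. (2) If $q+2p>1$ and, for every $m$, $\pi_t\ge 1-m^{-q}$ for all $t=1,\dots,m$, then $H_0$ and $H_1^{(\mathrm{mix})}$ merge asymptotically as $m\to\infty$; that is, for any sequence of tests the sum of type I and type II error probabilities tends to $1$, so no test can reliably separate $H_0$ and $H_1^{(\mathrm{mix})}$.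
   Context: Hypotheses. For each $m$ one observes $\zeta_1,\dots,\zeta_m\in[0,1]$. Under $H_0$, $\zeta_1,\dots,\zeta_m$ are i.i.d. $U[0,1]$. Under $H_1^{(\mathrm{mix})}$, $\zeta_1,\dots,\zeta_m$ are independent and $\zeta_t\sim(1-\varepsilon_m)U[0,1]+\varepsilon_m U[0,\pi_t]$ (a mixture distribution), where $\pi_t\in(0,1]$ are given numbers. (In the watermarking application $\pi_t=P_{t,\mathcal{G}_t}=\sum_{w\in\mathcal{G}_t}P_{t,w}$ is the total next-token probability of the green list $\mathcal{G}_t$ at step $t$; one conditions on these quantities.) A test is a measurable decision rule based on $(\zeta_1,\dots,\zeta_m)$; type I error is the probability under $H_0$ of rejecting $H_0$, type II error is the probability under $H_1^{(\mathrm{mix})}$ of not rejecting $H_0$. The hypotheses "separate asymptotically" if the total variation distance between the joint laws of $(\zeta_1,\dots,\zeta_m)$ under the two hypotheses tends to $1$ as $m\to\infty$; they "merge asymptotically" if this distance tends to $0$ (equivalently, the sum of type I and type II errors of any sequence of tests tends to $1$). The likelihood ratio test rejects $H_0$ if and only if $\sum_{t=1}^m\log\big(1+\varepsilon_m(g_t(\zeta_t)-1)\big)>0$, where $g_t(y)=\pi_t^{-1}\mathbf{1}_{\{0\le y\le\pi_t\}}$ is the density of $U[0,\pi_t]$. *)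

theory Defs
  imports "HOL-Probability.Probability"
begin

definition total_variation_distance :: "'a measure \<Rightarrow> 'a measure \<Rightarrow> real" where
  "total_variation_distance M N = (SUP A\<in>sets M. \<bar>measure M A - measure N A\<bar>)"

definition separate_asymptotically :: "(nat \<Rightarrow> 'a measure) \<Rightarrow> (nat \<Rightarrow> 'a measure) \<Rightarrow> bool" where
  "separate_asymptotically P Q \<longleftrightarrow> (\<lambda>m. total_variation_distance (P m) (Q m)) \<longlonglongrightarrow> 1"

definition merge_asymptotically :: "(nat \<Rightarrow> 'a measure) \<Rightarrow> (nat \<Rightarrow> 'a measure) \<Rightarrow> bool" where
  "merge_asymptotically P Q \<longleftrightarrow> (\<lambda>m. total_variation_distance (P m) (Q m)) \<longlonglongrightarrow> 0"

text \<open>The law \<open>(1 - w) M + w N\<close>. The set function is countably additive when \<open>M\<close> and \<open>N\<close> live on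
  the same measurable space, so \<^const>\<open>measure_of\<close> returns it unchanged; see \<open>emeasure_mixture\<close>.\<close>

definition mixture :: "real \<Rightarrow> 'a measure \<Rightarrow> 'a measure \<Rightarrow> 'a measure" where
  "mixture w M N = measure_of (space M) (sets M)
     (\<lambda>A. ennreal (1 - w) * emeasure M A + ennreal w * emeasure N A)"

lemma space_mixture [simp]: "space (mixture w M N) = space M"
  by (simp add: mixture_def)

lemma sets_mixture [simp, measurable_cong]: "sets (mixture w M N) = sets M"
  by (simp add: mixture_def)

lemma emeasure_mixture:
  assumes "sets N = sets M" and "A \<in> sets M"
  shows "emeasure (mixture w M N) A = ennreal (1 - w) * emeasure M A + ennreal w * emeasure N A"
proof (rule emeasure_measure_of[OF mixture_def])
  show "sets M \<subseteq> Pow (space M)"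
    by (rule sets.space_closed)
  show "A \<in> sets (mixture w M N)"
    using assms by simp
  show "positive (sets (mixture w M N))
      (\<lambda>A. ennreal (1 - w) * emeasure M A + ennreal w * emeasure N A)"
    by (simp add: positive_def)
  show "countably_additive (sets (mixture w M N))
      (\<lambda>A. ennreal (1 - w) * emeasure M A + ennreal w * emeasure N A)"
  proof (rule countably_additiveI)
    fix F :: "nat \<Rightarrow> 'a set"
    assume F: "range F \<subseteq> sets (mixture w M N)" "disjoint_family F"
    then have M: "range F \<subseteq> sets M" and N: "range F \<subseteq> sets N"
      using assms(1) by simp_all
    show "(\<Sum>i. ennreal (1 - w) * emeasure M (F i) + ennreal w * emeasure N (F i)) =
        ennreal (1 - w) * emeasure M (\<Union> (range F)) + ennreal w * emeasure N (\<Union> (range F))"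
      by (simp add: suminf_add[symmetric] suminf_emeasure[OF M F(2)] suminf_emeasure[OF N F(2)])
  qed
qed

lemma prob_space_mixture:
  assumes "prob_space M" "prob_space N" "sets N = sets M" "0 \<le> w" "w \<le> 1"
  shows "prob_space (mixture w M N)"
proof (rule prob_spaceI)
  have "emeasure N (space M) = 1"
    using prob_space.emeasure_space_1[OF assms(2)] sets_eq_imp_space_eq[OF assms(3)] by simp
  then show "emeasure (mixture w M N) (space (mixture w M N)) = 1"
    using assms
    by (simp add: emeasure_mixture prob_space.emeasure_space_1 ennreal_plus[symmetric]
        del: ennreal_plus)
qed

abbreviation uniform_upto :: "real \<Rightarrow> real measure" where
  "uniform_upto a \<equiv> uniform_measure lborel {0..a}"

text \<open>Joint laws of the observations \<open>x 1, \<dots>, x m\<close> under the two hypotheses. They are measures on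
  \<open>\<real>\<^sup>m\<close> concentrated on \<open>[0,1]\<^sup>m\<close>.\<close>

definition H0_law :: "nat \<Rightarrow> (nat \<Rightarrow> real) measure" where
  "H0_law m = (\<Pi>\<^sub>M t\<in>{1..m}. uniform_upto 1)"

definition H1_mix_law :: "real \<Rightarrow> (nat \<Rightarrow> real) \<Rightarrow> nat \<Rightarrow> (nat \<Rightarrow> real) measure" where
  "H1_mix_law \<epsilon> \<pi> m = (\<Pi>\<^sub>M t\<in>{1..m}. mixture \<epsilon> (uniform_upto 1) (uniform_upto (\<pi> t)))"

text \<open>A test maps the observations to \<open>True\<close> if \<open>H\<^sub>0\<close> is rejected.\<close>

definition is_test :: "nat \<Rightarrow> ((nat \<Rightarrow> real) \<Rightarrow> bool) \<Rightarrow> bool" where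
  "is_test m \<phi> \<longleftrightarrow> \<phi> \<in> (\<Pi>\<^sub>M t\<in>{1..m}. borel) \<rightarrow>\<^sub>M count_space UNIV"

definition type_I_error :: "'a measure \<Rightarrow> ('a \<Rightarrow> bool) \<Rightarrow> real" where
  "type_I_error P0 \<phi> = measure P0 {x \<in> space P0. \<phi> x}"

definition type_II_error :: "'a measure \<Rightarrow> ('a \<Rightarrow> bool) \<Rightarrow> real" where
  "type_II_error P1 \<phi> = measure P1 {x \<in> space P1. \<not> \<phi> x}"

definition uniform_density :: "real \<Rightarrow> real \<Rightarrow> real" where
  "uniform_density a y = inverse a * indicator {0..a} y"

definition likelihood_ratio_test :: "real \<Rightarrow> (nat \<Rightarrow> real) \<Rightarrow> nat \<Rightarrow> (nat \<Rightarrow> real) \<Rightarrow> bool" where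
  "likelihood_ratio_test \<epsilon> \<pi> m x \<longleftrightarrow>
     (\<Sum>t=1..m. ln (1 + \<epsilon> * (uniform_density (\<pi> t) (x t) - 1))) > 0"

lemma sets_H0_law: "sets (H0_law m) = sets (\<Pi>\<^sub>M t\<in>{1..m}. borel)"
  unfolding H0_law_def by (intro sets_PiM_cong) simp_all

lemma sets_H1_mix_law: "sets (H1_mix_law \<epsilon> \<pi> m) = sets (\<Pi>\<^sub>M t\<in>{1..m}. borel)"
  unfolding H1_mix_law_def by (intro sets_PiM_cong) simp_all

lemma is_test_likelihood_ratio_test: "is_test m (likelihood_ratio_test \<epsilon> \<pi> m)"
  unfolding is_test_def likelihood_ratio_test_def uniform_density_def by measurable

lemma prob_space_uniform_upto: "0 < a \<Longrightarrow> prob_space (uniform_upto a)"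
  by (rule prob_space_uniform_measure) simp_all

lemma prob_space_H0_law: "prob_space (H0_law m)"
  unfolding H0_law_def by (intro prob_space_PiM prob_space_uniform_upto) simp

lemma prob_space_H1_mix_law:
  assumes "0 \<le> \<epsilon>" "\<epsilon> \<le> 1" "\<And>t. t \<in> {1..m} \<Longrightarrow> 0 < \<pi> t"
  shows "prob_space (H1_mix_law \<epsilon> \<pi> m)"
  unfolding H1_mix_law_def
  using assms by (intro prob_space_PiM prob_space_mixture prob_space_uniform_upto) simp_all

end

theory Submission
  imports Defs "HOL-Real_Asymp.Real_Asymp"
begin

text \<open>Under \<open>H\<^sub>0\<close> the law of \<open>H\<^sub>1\<close> has density \<open>L = (\<Prod>t. 1 + \<epsilon> (g\<^sub>t - 1))\<close>. The two errors of the
  likelihood ratio test add up to \<open>E\<^sub>0 (min 1 L) \<le> E\<^sub>0 (sqrt L)\<close>, a product of factors each at most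
  \<open>1 - \<epsilon>\<^sup>2 (1 - \<pi>\<^sub>t) / 8\<close>; in case (1) this is at most \<open>exp (- m powr (1 - q - 2 p) / 8)\<close>.
  Conversely \<open>\<bar>P\<^sub>0 A - P\<^sub>1 A\<bar> \<le> E\<^sub>0 \<bar>L - 1\<bar> \<le> sqrt (E\<^sub>0 L\<^sup>2 - 1)\<close>, where \<open>E\<^sub>0 L\<^sup>2\<close> is the product of the
  \<open>1 + \<epsilon>\<^sup>2 (1 / \<pi>\<^sub>t - 1)\<close> and is at most \<open>exp (C m powr (1 - q - 2 p))\<close> in case (2).\<close>

section \<open>Total variation distance and the errors of a test\<close>

text \<open>A real supremum dominates its members only if the family is bounded above; that both
  measures are probabilities supplies the bound 1.\<close>

lemma total_variation_distance_ge:
  assumes "prob_space M" "prob_space N" "A \<in> sets M"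
  shows "\<bar>measure M A - measure N A\<bar> \<le> total_variation_distance M N"
proof -
  interpret M: prob_space M by fact
  interpret N: prob_space N by fact
  have "bdd_above ((\<lambda>A. \<bar>measure M A - measure N A\<bar>) ` sets M)"
    by (rule bdd_aboveI2[where M = 1])
      (smt (verit) M.prob_le_1 N.prob_le_1 measure_nonneg)
  then show ?thesis
    unfolding total_variation_distance_def using assms(3) by (rule cSUP_upper2) simp
qed

lemma total_variation_distance_le:
  assumes "\<And>A. A \<in> sets M \<Longrightarrow> \<bar>measure M A - measure N A\<bar> \<le> B"
  shows "total_variation_distance M N \<le> B"
  unfolding total_variation_distance_def using assms by (intro cSUP_least) auto

lemma total_variation_distance_le_1:
  assumes "prob_space M" "prob_space N"
  shows "total_variation_distance M N \<le> 1"
proof -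
  interpret M: prob_space M by fact
  interpret N: prob_space N by fact
  show ?thesis
    by (rule total_variation_distance_le) (smt (verit) M.prob_le_1 N.prob_le_1 measure_nonneg)
qed

text \<open>The type II error is 1 minus the probability of rejection under \<open>N\<close>, so the
  error sum minus 1 is the difference of the two probabilities of one event, the rejection
  region.\<close>

lemma abs_errors_minus_1_le:
  assumes "prob_space M" "prob_space N" "sets N = sets M" "{x \<in> space M. \<phi> x} \<in> sets M"
  shows "\<bar>type_I_error M \<phi> + type_II_error N \<phi> - 1\<bar> \<le> total_variation_distance M N"
proof -
  interpret N: prob_space N by fact
  have sp: "space N = space M"
    using assms(3) by (rule sets_eq_imp_space_eq)
  have "type_II_error N \<phi> = 1 - measure N {x \<in> space M. \<phi> x}"
    using N.prob_neg[of \<phi>] assms(3,4) by (simp add: type_II_error_def sp)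
  then have "type_I_error M \<phi> + type_II_error N \<phi> - 1 =
      measure M {x \<in> space M. \<phi> x} - measure N {x \<in> space M. \<phi> x}"
    by (simp add: type_I_error_def)
  then show ?thesis
    using total_variation_distance_ge[OF assms(1,2,4)] by simp
qed

section \<open>Product densities, and error bounds from a density\<close>

text \<open>A product measure is determined by its values on boxes, and on a box the integral of a
  product of one-coordinate functions factorises.\<close>

lemma (in product_sigma_finite) density_PiM:
  assumes I: "finite I"
    and f: "\<And>i. i \<in> I \<Longrightarrow> f i \<in> borel_measurable (M i)"
    and sf: "\<And>i. i \<in> I \<Longrightarrow> sigma_finite_measure (density (M i) (f i))"
  shows "density (PiM I M) (\<lambda>x. \<Prod>i\<in>I. f i (x i)) = PiM I (\<lambda>i. density (M i) (f i))"
proof -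
  \<comment> \<open>Off \<open>I\<close> the family stays equal to \<open>M\<close>:
    \<open>product_sigma_finite\<close> asks for sigma-finiteness at every index, while
    \<open>sf\<close> gives it only on \<open>I\<close>.\<close>
  define N where "N i = (if i \<in> I then density (M i) (f i) else M i)" for i
  interpret N: product_sigma_finite N
    by (rule product_sigma_finite.intro) (use sf sigma_finite_measures in \<open>simp add: N_def\<close>)
  have setsN: "sets (PiM I N) = sets (PiM I M)"
    by (intro sets_PiM_cong) (simp_all add: N_def)
  have "density (PiM I M) (\<lambda>x. \<Prod>i\<in>I. f i (x i)) = PiM I N"
  proof (rule N.PiM_eqI[OF I])
    show "sets (density (PiM I M) (\<lambda>x. \<Prod>i\<in>I. f i (x i))) = sets (PiM I N)"
      by (simp add: setsN)
    fix A assume "\<And>i. i \<in> I \<Longrightarrow> A i \<in> sets (N i)"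
    then have A [measurable]: "\<And>i. i \<in> I \<Longrightarrow> A i \<in> sets (M i)"
      by (simp add: N_def)
    note f [measurable]
    have "emeasure (density (PiM I M) (\<lambda>x. \<Prod>i\<in>I. f i (x i))) (Pi\<^sub>E I A) =
        (\<integral>\<^sup>+x. (\<Prod>i\<in>I. f i (x i)) * indicator (Pi\<^sub>E I A) x \<partial>PiM I M)"
      using I A by (intro emeasure_density) (auto intro!: sets_PiM_I_finite)
    also have "\<dots> = (\<integral>\<^sup>+x. (\<Prod>i\<in>I. f i (x i) * indicator (A i) (x i)) \<partial>PiM I M)"
    proof (rule nn_integral_cong)
      fix x assume "x \<in> space (PiM I M)"
      then have "x \<in> Pi\<^sub>E I A \<longleftrightarrow> (\<forall>i\<in>I. x i \<in> A i)"
        by (auto simp: space_PiM PiE_def)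
      then show "(\<Prod>i\<in>I. f i (x i)) * indicator (Pi\<^sub>E I A) x =
          (\<Prod>i\<in>I. f i (x i) * indicator (A i) (x i))"
        using I by (auto simp: prod.distrib indicator_def)
    qed
    also have "\<dots> = (\<Prod>i\<in>I. \<integral>\<^sup>+x. f i x * indicator (A i) x \<partial>M i)"
      using I by (intro product_nn_integral_prod) auto
    also have "\<dots> = (\<Prod>i\<in>I. emeasure (N i) (A i))"
      by (intro prod.cong) (auto simp: N_def emeasure_density)
    finally show "emeasure (density (PiM I M) (\<lambda>x. \<Prod>i\<in>I. f i (x i))) (Pi\<^sub>E I A) =
        (\<Prod>i\<in>I. emeasure (N i) (A i))" .
  qed
  also have "\<dots> = PiM I (\<lambda>i. density (M i) (f i))"
    by (intro PiM_cong) (simp_all add: N_def)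
  finally show ?thesis .
qed

lemma measure_density_integral:
  fixes f :: "'a \<Rightarrow> real"
  assumes "f \<in> borel_measurable M" "\<And>x. 0 \<le> f x" "A \<in> sets M"
  shows "measure (density M f) A = (\<integral>x. f x * indicator A x \<partial>M)"
proof -
  have "measure (density M f) A = (\<integral>x. indicator A x \<partial>density M f)"
    using sets.sets_into_space[OF assms(3)] by (simp add: Int_absorb2)
  also have "\<dots> = (\<integral>x. f x * indicator A x \<partial>M)"
    using assms by (intro integral_real_density) auto
  finally show ?thesis .
qed

text \<open>Rejecting where f > 1 makes the error sum the integral of min 1 f, and min 1 f \<le>
  sqrt f pointwise. The bound is the Hellinger affinity, which, unlike min 1 f, factorises over
  independent coordinates.\<close>

lemma (in prob_space) likelihood_ratio_errors_le:
  fixes f :: "'a \<Rightarrow> real"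
  assumes f: "integrable M f" "\<And>x. 0 \<le> f x" and s: "integrable M (\<lambda>x. sqrt (f x))"
  shows "type_I_error M (\<lambda>x. f x > 1) + type_II_error (density M f) (\<lambda>x. f x > 1)
    \<le> expectation (\<lambda>x. sqrt (f x))"
proof -
  have [measurable]: "f \<in> borel_measurable M"
    using f(1) by simp
  let ?A = "{x \<in> space M. f x > 1}" and ?B = "{x \<in> space M. \<not> f x > 1}"
  have "type_I_error M (\<lambda>x. f x > 1) + type_II_error (density M f) (\<lambda>x. f x > 1) =
      (\<integral>x. indicator ?A x \<partial>M) + (\<integral>x. f x * indicator ?B x \<partial>M)"
    unfolding type_I_error_def type_II_error_def
    using f by (subst measure_density_integral) (auto simp: Int_absorb2)
  also have "\<dots> = (\<integral>x. indicator ?A x + f x * indicator ?B x \<partial>M)"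
    using f
    by (intro Bochner_Integration.integral_add[symmetric] integrable_real_mult_indicator
        integrable_real_indicator) (auto simp: less_top[symmetric])
  also have "\<dots> \<le> expectation (\<lambda>x. sqrt (f x))"
  proof (rule integral_mono)
    show "integrable M (\<lambda>x. indicator ?A x + f x * indicator ?B x)"
      using f
      by (intro Bochner_Integration.integrable_add integrable_real_mult_indicator
          integrable_real_indicator) (auto simp: less_top[symmetric])
    fix x assume "x \<in> space M"
    moreover have "f x \<le> sqrt (f x)" if "f x \<le> 1"
      using that f(2)[of x]
      by (intro real_le_rsqrt) (simp add: power2_eq_square mult_left_le)
    ultimately show "indicator ?A x + f x * indicator ?B x \<le> sqrt (f x)"
      by (auto simp: indicator_def)
  qed (use s in simp)
  finally show ?thesis .
qed

text \<open>The difference is the integral of 1 - f over \<open>A\<close>, so the L1 norm of f - 1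
  dominates it for every \<open>A\<close> at once. The L2 norm dominates in turn; its square is the
  chi-square divergence, equal to E f^2 - 1 because E f = 1.\<close>

lemma (in prob_space) abs_measure_diff_density_le:
  fixes f :: "'a \<Rightarrow> real"
  assumes f: "integrable M f" "\<And>x. 0 \<le> f x" "expectation f = 1"
    and f2: "integrable M (\<lambda>x. (f x)\<^sup>2)" and A [measurable]: "A \<in> sets M"
  shows "\<bar>measure M A - measure (density M f) A\<bar> \<le> sqrt (expectation (\<lambda>x. (f x)\<^sup>2) - 1)"
proof -
  have [measurable]: "f \<in> borel_measurable M"
    using f(1) by simp
  let ?g = "\<lambda>x. \<bar>f x - 1\<bar>"
  have g: "integrable M ?g" and g2: "integrable M (\<lambda>x. (?g x)\<^sup>2)"
    using f f2 by (auto simp: power2_diff)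
  have int: "integrable M (\<lambda>x. f x * indicator A x)" "integrable M (\<lambda>x. indicator A x :: real)"
    using f
    by (auto intro!: integrable_real_mult_indicator integrable_real_indicator
        simp: less_top[symmetric])
  have "measure M A - measure (density M f) A =
      (\<integral>x. indicator A x \<partial>M) - (\<integral>x. f x * indicator A x \<partial>M)"
    using f sets.sets_into_space[OF A] by (simp add: measure_density_integral Int_absorb2)
  also have "\<dots> = (\<integral>x. indicator A x - f x * indicator A x \<partial>M)"
    using int by simp
  finally have "\<bar>measure M A - measure (density M f) A\<bar> =
      \<bar>\<integral>x. indicator A x - f x * indicator A x \<partial>M\<bar>"
    by simp
  also have "\<dots> \<le> (\<integral>x. \<bar>indicator A x - f x * indicator A x\<bar> \<partial>M)"
    by (rule integral_abs_bound)
  also have "\<dots> \<le> expectation ?g"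
    using int g by (intro integral_mono) (auto simp: indicator_def)
  \<comment> \<open>Cauchy-Schwarz on a probability space, read off from the nonnegativity of the
    variance of \<open>?g\<close>.\<close>
  also have "\<dots> \<le> sqrt (expectation (\<lambda>x. (?g x)\<^sup>2))"
    using variance_eq[OF g g2] variance_positive[of ?g] by (intro real_le_rsqrt) simp
  also have "expectation (\<lambda>x. (?g x)\<^sup>2) = expectation (\<lambda>x. (f x)\<^sup>2) - 1"
    using f f2 by (simp add: power2_diff prob_space)
  finally show ?thesis .
qed

section \<open>The likelihood ratio of a single observation\<close>

lemma measure_uniform_upto_1:
  assumes "0 \<le> a" "a \<le> 1"
  shows "measure (uniform_upto 1) {0..a} = a"
  using assms by (subst measure_uniform_measure) auto

text \<open>The likelihood ratio of one observation takes one value on [0,a] and another off it, so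
  any function of it is such a step function; this single integral serves for its mean, second
  moment and affinity.\<close>

lemma has_bochner_integral_uniform_upto_1_step:
  fixes u v :: real
  assumes "0 \<le> a" "a \<le> 1"
  shows "has_bochner_integral (uniform_upto 1) (\<lambda>x. if x \<in> {0..a} then u else v)
    (a * u + (1 - a) * v)"
proof -
  interpret prob_space "uniform_upto 1"
    by (rule prob_space_uniform_upto) simp
  have "integrable (uniform_upto 1) (indicator {0..a} :: real \<Rightarrow> real)"
    by (intro integrable_real_indicator)
      (simp_all add: less_top[symmetric] del: emeasure_uniform_measure)
  then have "has_bochner_integral (uniform_upto 1) (\<lambda>x. v + (u - v) * indicator {0..a} x)
      (v + (u - v) * a)"
    using measure_uniform_upto_1[OF assms] by (simp add: has_bochner_integral_iff prob_space)
  moreover have "(\<lambda>x. v + (u - v) * indicator {0..a} x) = (\<lambda>x. if x \<in> {0..a} then u else v)"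
    by (auto simp: indicator_def)
  ultimately show ?thesis
    by (simp add: algebra_simps)
qed

definition likelihood_factor :: "real \<Rightarrow> real \<Rightarrow> real \<Rightarrow> real" where
  "likelihood_factor \<epsilon> a y = 1 + \<epsilon> * (uniform_density a y - 1)"

lemma likelihood_factor_eq:
  "likelihood_factor \<epsilon> a y = (if y \<in> {0..a} then 1 + \<epsilon> * (1 / a - 1) else 1 - \<epsilon>)"
  by (simp add: likelihood_factor_def uniform_density_def inverse_eq_divide)

lemma borel_measurable_likelihood_factor [measurable]:
  "likelihood_factor \<epsilon> a \<in> borel_measurable borel"
  unfolding likelihood_factor_def uniform_density_def by measurable

lemma likelihood_factor_pos:
  assumes "0 \<le> \<epsilon>" "\<epsilon> < 1" "0 < a"
  shows "0 < likelihood_factor \<epsilon> a y"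
proof -
  have "0 \<le> \<epsilon> * uniform_density a y"
    using assms by (simp add: uniform_density_def)
  then show ?thesis
    using assms by (simp add: likelihood_factor_def algebra_simps)
qed

text \<open>The factor splits as (1 - \<epsilon>) plus \<epsilon>/a times the indicator of [0,a];
  the two summands are the densities of the two components of the mixture, with their
  weights.\<close>

lemma mixture_uniform_eq_density:
  assumes \<epsilon>: "0 \<le> \<epsilon>" "\<epsilon> < 1" and a: "0 < a" "a \<le> 1"
  shows "mixture \<epsilon> (uniform_upto 1) (uniform_upto a) =
    density (uniform_upto 1) (likelihood_factor \<epsilon> a)"
proof (rule measure_eqI)
  fix A assume "A \<in> sets (mixture \<epsilon> (uniform_upto 1) (uniform_upto a))"
  then have A [measurable]: "A \<in> sets borel"
    by simp
  have *: "ennreal (likelihood_factor \<epsilon> a x) =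
      ennreal (1 - \<epsilon>) + ennreal (\<epsilon> / a) * indicator {0..a} x" for x
    using \<epsilon> a by (auto simp: likelihood_factor_eq indicator_def ennreal_plus[symmetric] field_simps
        simp del: ennreal_plus intro!: arg_cong[where f = ennreal])
  have "emeasure (density (uniform_upto 1) (likelihood_factor \<epsilon> a)) A =
      (\<integral>\<^sup>+x. ennreal (1 - \<epsilon>) * indicator A x +
        ennreal (\<epsilon> / a) * indicator ({0..a} \<inter> A) x \<partial>uniform_upto 1)"
    by (subst emeasure_density) (auto simp: * indicator_def intro!: nn_integral_cong)
  also have "\<dots> = ennreal (1 - \<epsilon>) * emeasure (uniform_upto 1) A +
      ennreal (\<epsilon> / a) * emeasure (uniform_upto 1) ({0..a} \<inter> A)"
    by (simp add: nn_integral_add nn_integral_cmult)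
  \<comment> \<open>Since a \<le> 1, the interval [0,a] lies in [0,1], where the uniform law is
    Lebesgue measure.\<close>
  also have "emeasure (uniform_upto 1) ({0..a} \<inter> A) = emeasure lborel ({0..a} \<inter> A)"
    using a by (simp add: Int_assoc[symmetric] Int_absorb1 divide_ennreal_def)
  also have "ennreal (\<epsilon> / a) * emeasure lborel ({0..a} \<inter> A) =
      ennreal \<epsilon> * emeasure (uniform_upto a) A"
    using \<epsilon> a by (simp add: divide_ennreal_def inverse_ennreal ennreal_mult divide_inverse
        ac_simps)
  finally show "emeasure (mixture \<epsilon> (uniform_upto 1) (uniform_upto a)) A =
      emeasure (density (uniform_upto 1) (likelihood_factor \<epsilon> a)) A"
    by (simp add: emeasure_mixture)
qed simp

section \<open>The joint likelihood ratio and its moments for fixed sample size\<close>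

definition likelihood_ratio :: "real \<Rightarrow> (nat \<Rightarrow> real) \<Rightarrow> nat \<Rightarrow> (nat \<Rightarrow> real) \<Rightarrow> real" where
  "likelihood_ratio \<epsilon> \<pi> m x = (\<Prod>t=1..m. likelihood_factor \<epsilon> (\<pi> t) (x t))"

lemma product_sigma_finite_uniform_upto_1: "product_sigma_finite (\<lambda>t. uniform_upto 1)"
proof (rule product_sigma_finite.intro)
  interpret prob_space "uniform_upto 1"
    by (rule prob_space_uniform_upto) simp
  show "sigma_finite_measure (uniform_upto 1)" by standard
qed

text \<open>Under the null hypothesis the coordinates are independent, so the expectation is a
  product of step integrals. \<open>G\<close> is left free so that the identity, the square and the
  square root give mean, second moment and affinity.\<close>

lemma has_bochner_integral_H0_law:
  fixes G :: "real \<Rightarrow> real"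
  assumes "\<And>t. t \<in> {1..m} \<Longrightarrow> \<pi> t \<in> {0<..1}"
  shows "has_bochner_integral (H0_law m) (\<lambda>x. \<Prod>t=1..m. G (likelihood_factor \<epsilon> (\<pi> t) (x t)))
    (\<Prod>t=1..m. \<pi> t * G (1 + \<epsilon> * (1 / \<pi> t - 1)) + (1 - \<pi> t) * G (1 - \<epsilon>))"
proof -
  interpret product_sigma_finite "\<lambda>t :: nat. uniform_upto 1"
    by (rule product_sigma_finite_uniform_upto_1)
  have *: "has_bochner_integral (uniform_upto 1) (\<lambda>y. G (likelihood_factor \<epsilon> (\<pi> t) y))
      (\<pi> t * G (1 + \<epsilon> * (1 / \<pi> t - 1)) + (1 - \<pi> t) * G (1 - \<epsilon>))" if "t \<in> {1..m}" for t
    using has_bochner_integral_uniform_upto_1_step[of "\<pi> t"] assms[OF that]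
    by (simp add: likelihood_factor_eq if_distrib[of G])
  have "integrable (H0_law m) (\<lambda>x. \<Prod>t=1..m. G (likelihood_factor \<epsilon> (\<pi> t) (x t)))"
    unfolding H0_law_def
    by (rule product_integrable_prod[where f = "\<lambda>t y. G (likelihood_factor \<epsilon> (\<pi> t) y)"])
      (use * in \<open>auto simp: has_bochner_integral_iff\<close>)
  moreover have "(\<integral>x. (\<Prod>t=1..m. G (likelihood_factor \<epsilon> (\<pi> t) (x t))) \<partial>H0_law m) =
      (\<Prod>t=1..m. \<integral>y. G (likelihood_factor \<epsilon> (\<pi> t) y) \<partial>uniform_upto 1)"
    unfolding H0_law_def
    by (rule product_integral_prod[where f = "\<lambda>t y. G (likelihood_factor \<epsilon> (\<pi> t) y)"])
      (use * in \<open>auto simp: has_bochner_integral_iff\<close>)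
  moreover have "\<dots> = (\<Prod>t=1..m. \<pi> t * G (1 + \<epsilon> * (1 / \<pi> t - 1)) + (1 - \<pi> t) * G (1 - \<epsilon>))"
    by (intro prod.cong) (use * in \<open>auto simp: has_bochner_integral_iff\<close>)
  ultimately show ?thesis
    by (simp add: has_bochner_integral_iff)
qed

text \<open>The strict bound \<epsilon> < 1 keeps the likelihood ratio positive, also where some
  observation exceeds \<pi>; hence all the logarithms in the test are genuine.\<close>

locale mixture_detection =
  fixes \<epsilon> :: real and \<pi> :: "nat \<Rightarrow> real" and m :: nat
  assumes eps: "0 \<le> \<epsilon>" "\<epsilon> < 1" and pi: "\<And>t. t \<in> {1..m} \<Longrightarrow> \<pi> t \<in> {0<..1}"
begin

sublocale H0: prob_space "H0_law m"
  by (rule prob_space_H0_law)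

sublocale H1: prob_space "H1_mix_law \<epsilon> \<pi> m"
  using eps pi by (intro prob_space_H1_mix_law) auto

lemma factor_pos: "t \<in> {1..m} \<Longrightarrow> 0 < likelihood_factor \<epsilon> (\<pi> t) y"
  using eps pi by (intro likelihood_factor_pos) auto

lemma likelihood_ratio_pos: "0 < likelihood_ratio \<epsilon> \<pi> m x"
  unfolding likelihood_ratio_def by (intro prod_pos factor_pos)

lemma H1_mix_law_eq_density: "H1_mix_law \<epsilon> \<pi> m = density (H0_law m) (likelihood_ratio \<epsilon> \<pi> m)"
proof -
  interpret product_sigma_finite "\<lambda>t :: nat. uniform_upto 1"
    by (rule product_sigma_finite_uniform_upto_1)
  have mix: "mixture \<epsilon> (uniform_upto 1) (uniform_upto (\<pi> t)) =
      density (uniform_upto 1) (likelihood_factor \<epsilon> (\<pi> t))" if "t \<in> {1..m}" for t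
    using that eps pi by (intro mixture_uniform_eq_density) auto
  \<comment> \<open>Each coordinate density is sigma-finite because it is the mixture law, a
    probability measure.\<close>
  have "sigma_finite_measure (density (uniform_upto 1) (likelihood_factor \<epsilon> (\<pi> t)))"
    if t: "t \<in> {1..m}" for t
  proof -
    interpret prob_space "mixture \<epsilon> (uniform_upto 1) (uniform_upto (\<pi> t))"
      using eps pi[OF t] by (intro prob_space_mixture prob_space_uniform_upto) auto
    show ?thesis
      unfolding mix[OF t, symmetric] by standard
  qed
  then have "density (H0_law m) (\<lambda>x. \<Prod>t=1..m. ennreal (likelihood_factor \<epsilon> (\<pi> t) (x t))) =
      (\<Pi>\<^sub>M t\<in>{1..m}. density (uniform_upto 1) (likelihood_factor \<epsilon> (\<pi> t)))"
    unfolding H0_law_def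
    by (intro density_PiM[where f = "\<lambda>t y. ennreal (likelihood_factor \<epsilon> (\<pi> t) y)"]) auto
  moreover have "(\<Prod>t=1..m. ennreal (likelihood_factor \<epsilon> (\<pi> t) (x t))) =
      ennreal (likelihood_ratio \<epsilon> \<pi> m x)" for x
    unfolding likelihood_ratio_def using factor_pos by (intro prod_ennreal) (auto intro: less_imp_le)
  moreover have "H1_mix_law \<epsilon> \<pi> m =
      (\<Pi>\<^sub>M t\<in>{1..m}. density (uniform_upto 1) (likelihood_factor \<epsilon> (\<pi> t)))"
    unfolding H1_mix_law_def by (intro PiM_cong mix) auto
  ultimately show ?thesis
    by simp
qed

lemma likelihood_ratio_test_iff:
  "likelihood_ratio_test \<epsilon> \<pi> m x \<longleftrightarrow> likelihood_ratio \<epsilon> \<pi> m x > 1"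
proof -
  have "ln (likelihood_ratio \<epsilon> \<pi> m x) = (\<Sum>t=1..m. ln (likelihood_factor \<epsilon> (\<pi> t) (x t)))"
    unfolding likelihood_ratio_def using factor_pos by (intro ln_prod) (auto simp: less_imp_neq[symmetric])
  then have "likelihood_ratio_test \<epsilon> \<pi> m x \<longleftrightarrow> ln (likelihood_ratio \<epsilon> \<pi> m x) > 0"
    by (simp add: likelihood_ratio_test_def likelihood_factor_def)
  then show ?thesis
    using likelihood_ratio_pos[of x] by (simp add: ln_gt_zero_iff)
qed

lemma has_bochner_integral_likelihood_ratio:
  "has_bochner_integral (H0_law m) (likelihood_ratio \<epsilon> \<pi> m) 1"
proof -
  have "(\<Prod>t=1..m. \<pi> t * (1 + \<epsilon> * (1 / \<pi> t - 1)) + (1 - \<pi> t) * (1 - \<epsilon>)) = 1"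
  proof (rule prod.neutral, intro ballI)
    fix t assume "t \<in> {1..m}"
    then have "\<pi> t \<noteq> 0"
      using pi[of t] by auto
    then show "\<pi> t * (1 + \<epsilon> * (1 / \<pi> t - 1)) + (1 - \<pi> t) * (1 - \<epsilon>) = 1"
      by (simp add: field_simps)
  qed
  then show ?thesis
    using has_bochner_integral_H0_law[where \<pi> = \<pi> and m = m and G = "\<lambda>z. z" and \<epsilon> = \<epsilon>, OF pi]
    by (simp add: likelihood_ratio_def[abs_def])
qed

text \<open>The density of U[0,\<pi>] has chi-square divergence 1/\<pi> - 1 from U[0,1]; mixing with
  weight \<epsilon> scales the deviation from 1 by \<epsilon>, hence its second moment by the square
  of \<epsilon>.\<close>

lemma has_bochner_integral_likelihood_ratio_power2:
  "has_bochner_integral (H0_law m) (\<lambda>x. (likelihood_ratio \<epsilon> \<pi> m x)\<^sup>2)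
    (\<Prod>t=1..m. 1 + \<epsilon>\<^sup>2 * (1 / \<pi> t - 1))"
proof -
  have "(\<Prod>t=1..m. \<pi> t * (1 + \<epsilon> * (1 / \<pi> t - 1))\<^sup>2 + (1 - \<pi> t) * (1 - \<epsilon>)\<^sup>2) =
      (\<Prod>t=1..m. 1 + \<epsilon>\<^sup>2 * (1 / \<pi> t - 1))"
  proof (rule prod.cong)
    fix t assume "t \<in> {1..m}"
    then have "\<pi> t \<noteq> 0"
      using pi[of t] by auto
    then show "\<pi> t * (1 + \<epsilon> * (1 / \<pi> t - 1))\<^sup>2 + (1 - \<pi> t) * (1 - \<epsilon>)\<^sup>2 =
        1 + \<epsilon>\<^sup>2 * (1 / \<pi> t - 1)"
      by (simp add: field_simps power2_eq_square)
  qed simp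
  then show ?thesis
    using has_bochner_integral_H0_law[where \<pi> = \<pi> and m = m and G = power2 and \<epsilon> = \<epsilon>, OF pi]
    by (simp add: likelihood_ratio_def[abs_def] prod_power_distrib)
qed

lemma total_variation_distance_bound:
  "total_variation_distance (H0_law m) (H1_mix_law \<epsilon> \<pi> m)
    \<le> sqrt ((\<Prod>t=1..m. 1 + \<epsilon>\<^sup>2 * (1 / \<pi> t - 1)) - 1)"
  using has_bochner_integral_likelihood_ratio has_bochner_integral_likelihood_ratio_power2
    H0.abs_measure_diff_density_le[of "likelihood_ratio \<epsilon> \<pi> m"] less_imp_le[OF likelihood_ratio_pos]
  by (intro total_variation_distance_le) (simp add: has_bochner_integral_iff H1_mix_law_eq_density)

text \<open>The first square root is bounded by its tangent, the second by its second-order Taylor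
  polynomial. The terms linear in \<epsilon> cancel because the factor has mean 1, leaving the
  quadratic term with weight 1 - \<pi>.\<close>

lemma affinity_factor_le:
  assumes t: "t \<in> {1..m}"
  shows "\<pi> t * sqrt (1 + \<epsilon> * (1 / \<pi> t - 1)) + (1 - \<pi> t) * sqrt (1 - \<epsilon>)
    \<le> 1 - \<epsilon>\<^sup>2 * (1 - \<pi> t) / 8"
proof -
  have \<pi>: "0 < \<pi> t" "\<pi> t \<le> 1"
    using pi[OF t] by auto
  have "0 \<le> \<epsilon> * (1 / \<pi> t - 1)"
    using eps \<pi> by simp
  moreover have "sqrt (1 + u) \<le> 1 + u / 2" if "0 \<le> u" for u :: real
    using that by (intro real_le_lsqrt) (auto simp: power2_eq_square field_simps)
  ultimately have "sqrt (1 + \<epsilon> * (1 / \<pi> t - 1)) \<le> 1 + \<epsilon> * (1 / \<pi> t - 1) / 2"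
    by blast
  then have 1: "\<pi> t * sqrt (1 + \<epsilon> * (1 / \<pi> t - 1)) \<le> \<pi> t * (1 + \<epsilon> * (1 / \<pi> t - 1) / 2)"
    using \<pi> by (intro mult_left_mono) auto
  \<comment> \<open>This makes 1 - \<epsilon>/2 - \<epsilon>^2/8 nonnegative, as required for
    comparing it with a square root by squaring.\<close>
  have sq: "\<epsilon>\<^sup>2 \<le> \<epsilon>"
    using eps by (simp add: power2_eq_square mult_left_le)
  \<comment> \<open>With coefficient 1/8 the quadratic terms of the square cancel, and what remains
    beyond 1 - \<epsilon> is nonnegative.\<close>
  have "(1 - \<epsilon> / 2 - \<epsilon>\<^sup>2 / 8)\<^sup>2 = 1 - \<epsilon> + \<epsilon>\<^sup>2 * \<epsilon> / 8 + (\<epsilon>\<^sup>2 / 8)\<^sup>2"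
    by (simp add: power2_eq_square field_simps)
  then have "1 - \<epsilon> \<le> (1 - \<epsilon> / 2 - \<epsilon>\<^sup>2 / 8)\<^sup>2"
    using eps by simp
  then have "sqrt (1 - \<epsilon>) \<le> 1 - \<epsilon> / 2 - \<epsilon>\<^sup>2 / 8"
    using eps sq by (intro real_le_lsqrt) auto
  then have 2: "(1 - \<pi> t) * sqrt (1 - \<epsilon>) \<le> (1 - \<pi> t) * (1 - \<epsilon> / 2 - \<epsilon>\<^sup>2 / 8)"
    using \<pi> by (intro mult_left_mono) auto
  have "\<pi> t * (1 + \<epsilon> * (1 / \<pi> t - 1) / 2) + (1 - \<pi> t) * (1 - \<epsilon> / 2 - \<epsilon>\<^sup>2 / 8) =
      1 - \<epsilon>\<^sup>2 * (1 - \<pi> t) / 8"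
    using \<pi> by (simp add: field_simps)
  then show ?thesis
    using 1 2 by linarith
qed

lemma likelihood_ratio_test_errors_le:
  "type_I_error (H0_law m) (likelihood_ratio_test \<epsilon> \<pi> m) +
    type_II_error (H1_mix_law \<epsilon> \<pi> m) (likelihood_ratio_test \<epsilon> \<pi> m)
    \<le> exp (- (\<Sum>t=1..m. \<epsilon>\<^sup>2 * (1 - \<pi> t) / 8))"
proof -
  let ?L = "likelihood_ratio \<epsilon> \<pi> m"
  let ?\<rho> = "\<lambda>t. \<pi> t * sqrt (1 + \<epsilon> * (1 / \<pi> t - 1)) + (1 - \<pi> t) * sqrt (1 - \<epsilon>)"
  have "sqrt (?L x) = (\<Prod>t=1..m. sqrt (likelihood_factor \<epsilon> (\<pi> t) (x t)))" for x
    unfolding likelihood_ratio_def by (induction m) (simp_all add: real_sqrt_mult)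
  then have s: "has_bochner_integral (H0_law m) (\<lambda>x. sqrt (?L x)) (\<Prod>t=1..m. ?\<rho> t)"
    using has_bochner_integral_H0_law[where \<pi> = \<pi> and m = m and G = sqrt and \<epsilon> = \<epsilon>, OF pi] by simp
  have "type_I_error (H0_law m) (\<lambda>x. ?L x > 1) + type_II_error (density (H0_law m) ?L) (\<lambda>x. ?L x > 1)
      \<le> H0.expectation (\<lambda>x. sqrt (?L x))"
    using s has_bochner_integral_likelihood_ratio less_imp_le[OF likelihood_ratio_pos]
    by (intro H0.likelihood_ratio_errors_le) (auto simp: has_bochner_integral_iff)
  also have "\<dots> = (\<Prod>t=1..m. ?\<rho> t)"
    using s by (simp add: has_bochner_integral_iff)
  \<comment> \<open>The inequality 1 - x \<le> exp (-x) turns the product of affinities into the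
    exponential of a sum.\<close>
  also have "\<dots> \<le> (\<Prod>t=1..m. exp (- (\<epsilon>\<^sup>2 * (1 - \<pi> t) / 8)))"
  proof (intro prod_mono conjI)
    fix t assume t: "t \<in> {1..m}"
    have "0 \<le> \<epsilon> * (1 / \<pi> t - 1)"
      using eps pi[OF t] by (intro mult_nonneg_nonneg) auto
    then show "0 \<le> ?\<rho> t"
      using eps pi[OF t] by (intro add_nonneg_nonneg mult_nonneg_nonneg) auto
    show "?\<rho> t \<le> exp (- (\<epsilon>\<^sup>2 * (1 - \<pi> t) / 8))"
      using affinity_factor_le[OF t] exp_ge_add_one_self[of "- (\<epsilon>\<^sup>2 * (1 - \<pi> t) / 8)"] by linarith
  qed
  also have "\<dots> = exp (- (\<Sum>t=1..m. \<epsilon>\<^sup>2 * (1 - \<pi> t) / 8))"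
    by (simp add: exp_sum[symmetric] sum_negf)
  finally show ?thesis
    by (simp add: H1_mix_law_eq_density likelihood_ratio_test_iff[abs_def])
qed

text \<open>Used in both directions: a good test forces the distance up towards 1, and a small
  distance forces the errors of every test to add up to nearly 1.\<close>

lemma abs_test_errors_minus_1_le:
  assumes "is_test m \<phi>"
  shows "\<bar>type_I_error (H0_law m) \<phi> + type_II_error (H1_mix_law \<epsilon> \<pi> m) \<phi> - 1\<bar>
    \<le> total_variation_distance (H0_law m) (H1_mix_law \<epsilon> \<pi> m)"
proof (rule abs_errors_minus_1_le)
  have "\<phi> \<in> H0_law m \<rightarrow>\<^sub>M count_space UNIV"
    using assms unfolding is_test_def by (simp add: measurable_cong_sets[OF sets_H0_law refl])
  then show "{x \<in> space (H0_law m). \<phi> x} \<in> sets (H0_law m)"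
    by measurable
qed (simp_all add: H0.prob_space_axioms H1.prob_space_axioms sets_H0_law sets_H1_mix_law)

end

section \<open>Asymptotics in the two regimes of q + 2p\<close>

theorem theorem3p5:
  fixes p q :: real and \<epsilon> :: "nat \<Rightarrow> real" and \<pi> :: "nat \<Rightarrow> nat \<Rightarrow> real"
  assumes "0 < p" "p < 1" "0 < q" "q < 1"
    and "\<And>m. m \<ge> 2 \<Longrightarrow> \<epsilon> m = real m powr (- p)"
    and "\<And>m t. m \<ge> 2 \<Longrightarrow> t \<in> {1..m} \<Longrightarrow> \<pi> m t \<in> {0<..1}"
  shows
    "(q + 2 * p < 1 \<and> (\<forall>m\<ge>2. \<forall>t\<in>{1..m}. \<pi> m t \<le> 1 - real m powr (- q)) \<longrightarrow>
        separate_asymptotically H0_law (\<lambda>m. H1_mix_law (\<epsilon> m) (\<pi> m) m) \<and>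
        (\<lambda>m. type_I_error (H0_law m) (likelihood_ratio_test (\<epsilon> m) (\<pi> m) m) +
             type_II_error (H1_mix_law (\<epsilon> m) (\<pi> m) m) (likelihood_ratio_test (\<epsilon> m) (\<pi> m) m))
          \<longlonglongrightarrow> 0)
     \<and>
     (q + 2 * p > 1 \<and> (\<forall>m\<ge>2. \<forall>t\<in>{1..m}. \<pi> m t \<ge> 1 - real m powr (- q)) \<longrightarrow>
        merge_asymptotically H0_law (\<lambda>m. H1_mix_law (\<epsilon> m) (\<pi> m) m) \<and>
        (\<forall>\<phi>. (\<forall>m\<ge>2. is_test m (\<phi> m)) \<longrightarrow>
          (\<lambda>m. type_I_error (H0_law m) (\<phi> m) + type_II_error (H1_mix_law (\<epsilon> m) (\<pi> m) m) (\<phi> m))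
            \<longlonglongrightarrow> 1 \<and>
          \<not> (\<lambda>m. type_I_error (H0_law m) (\<phi> m) + type_II_error (H1_mix_law (\<epsilon> m) (\<pi> m) m) (\<phi> m))
            \<longlonglongrightarrow> 0))"
proof (intro conjI impI)
  note p = assms(1,2) and q = assms(3,4) and eps_eq = assms(5) and pi01 = assms(6)
  have mix: "mixture_detection (\<epsilon> m) (\<pi> m) m" if "m \<ge> 2" for m
  proof
    \<comment> \<open>Strictness comes from m \<ge> 2 and p > 0.\<close>
    have "real m powr (- p) < 1"
      using that p by (simp add: powr_less_one)
    then show "0 \<le> \<epsilon> m" "\<epsilon> m < 1"
      using that by (simp_all add: eps_eq)
  qed (use that pi01 in auto)
  let ?TV = "\<lambda>m. total_variation_distance (H0_law m) (H1_mix_law (\<epsilon> m) (\<pi> m) m)"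
  let ?err = "\<lambda>\<phi> m. type_I_error (H0_law m) (\<phi> m) + type_II_error (H1_mix_law (\<epsilon> m) (\<pi> m) m) (\<phi> m)"
  let ?LRT = "\<lambda>m. likelihood_ratio_test (\<epsilon> m) (\<pi> m) m"
  \<comment> \<open>This is the total signal over m observations, up to a constant factor, in both
    cases; the sign of 1 - (q + 2p) decides whether it diverges or vanishes.\<close>
  have rate: "real m * ((\<epsilon> m)\<^sup>2 * real m powr (- q)) = real m powr (1 - (q + 2 * p))" if "m \<ge> 2" for m
  proof -
    have "real m * ((\<epsilon> m)\<^sup>2 * real m powr (- q)) =
        real m powr 1 * (real m powr (- p) * real m powr (- p) * real m powr (- q))"
      using that by (simp add: eps_eq power2_eq_square)
    then show ?thesis
      by (simp only: powr_add[symmetric]) (simp add: algebra_simps)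
  qed
  {
    assume "q + 2 * p < 1 \<and> (\<forall>m\<ge>2. \<forall>t\<in>{1..m}. \<pi> m t \<le> 1 - real m powr (- q))"
    then have r: "1 - (q + 2 * p) > 0"
      and ub: "\<And>m t. m \<ge> 2 \<Longrightarrow> t \<in> {1..m} \<Longrightarrow> \<pi> m t \<le> 1 - real m powr (- q)"
      by auto
    have bound: "?err ?LRT m \<le> exp (- (real m powr (1 - (q + 2 * p)) / 8))" if m: "m \<ge> 2" for m
    proof -
      interpret mixture_detection "\<epsilon> m" "\<pi> m" m by (rule mix[OF m])
      have "real m powr (1 - (q + 2 * p)) / 8 = (\<Sum>t=1..m. (\<epsilon> m)\<^sup>2 * real m powr (- q) / 8)"
        using rate[OF m] by simp
      also have "\<dots> \<le> (\<Sum>t=1..m. (\<epsilon> m)\<^sup>2 * (1 - \<pi> m t) / 8)"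
        using ub[OF m] by (intro sum_mono divide_right_mono mult_left_mono) (auto simp: algebra_simps)
      finally show ?thesis
        using likelihood_ratio_test_errors_le by (smt (verit) exp_le_cancel_iff)
    qed
    show lim: "?err ?LRT \<longlonglongrightarrow> 0"
    proof (rule tendsto_sandwich)
      show "\<forall>\<^sub>F m in sequentially. 0 \<le> ?err ?LRT m"
        by (simp add: type_I_error_def type_II_error_def)
      show "\<forall>\<^sub>F m in sequentially. ?err ?LRT m \<le> exp (- (real m powr (1 - (q + 2 * p)) / 8))"
        using bound by (rule eventually_at_top_linorderI)
      show "(\<lambda>m. exp (- (real m powr (1 - (q + 2 * p)) / 8))) \<longlonglongrightarrow> 0"
        using r by real_asymp
    qed simp
    \<comment> \<open>The likelihood ratio test witnesses the separation: its error sum tends to 0,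
      so the lower bound tends to 1.\<close>
    have TV: "1 - ?err ?LRT m \<le> ?TV m" "?TV m \<le> 1" if m: "m \<ge> 2" for m
    proof -
      interpret mixture_detection "\<epsilon> m" "\<pi> m" m by (rule mix[OF m])
      show "1 - ?err ?LRT m \<le> ?TV m"
        using abs_test_errors_minus_1_le[OF is_test_likelihood_ratio_test[of m "\<epsilon> m" "\<pi> m"]] by simp
      show "?TV m \<le> 1"
        by (intro total_variation_distance_le_1 H0.prob_space_axioms H1.prob_space_axioms)
    qed
    show "separate_asymptotically H0_law (\<lambda>m. H1_mix_law (\<epsilon> m) (\<pi> m) m)"
      unfolding separate_asymptotically_def
    proof (rule tendsto_sandwich)
      show "\<forall>\<^sub>F m in sequentially. 1 - ?err ?LRT m \<le> ?TV m"
        using TV(1) by (rule eventually_at_top_linorderI)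
      show "\<forall>\<^sub>F m in sequentially. ?TV m \<le> 1"
        using TV(2) by (rule eventually_at_top_linorderI)
      show "(\<lambda>m. 1 - ?err ?LRT m) \<longlonglongrightarrow> 1"
        using tendsto_diff[OF tendsto_const lim, of 1] by simp
    qed simp
  next
    assume "q + 2 * p > 1 \<and> (\<forall>m\<ge>2. \<forall>t\<in>{1..m}. \<pi> m t \<ge> 1 - real m powr (- q))"
    then have r: "1 - (q + 2 * p) < 0"
      and lb: "\<And>m t. m \<ge> 2 \<Longrightarrow> t \<in> {1..m} \<Longrightarrow> 1 - real m powr (- q) \<le> \<pi> m t"
      by auto
    \<comment> \<open>A lower bound for all \<open>\<pi> m t\<close> uniform in m \<ge> 2, since m
      powr (-q) is largest at m = 2. It keeps the denominator in (1 - \<pi>)/\<pi> away from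
      0.\<close>
    define c where "c = 1 - 2 powr (- q)"
    have c: "c > 0"
      using q by (simp add: c_def powr_less_one)
    have bound: "?TV m \<le> sqrt (exp (real m powr (1 - (q + 2 * p)) / c) - 1)" if m: "m \<ge> 2" for m
    proof -
      interpret mixture_detection "\<epsilon> m" "\<pi> m" m by (rule mix[OF m])
      have "1 / \<pi> m t - 1 \<le> real m powr (- q) / c" if t: "t \<in> {1..m}" for t
      proof -
        have "real m powr (- q) \<le> 2 powr (- q)"
          using m q by (intro powr_mono2') auto
        then have "c \<le> \<pi> m t"
          using lb[OF m t] by (simp add: c_def)
        then have "(1 - \<pi> m t) / \<pi> m t \<le> real m powr (- q) / c"
          using c lb[OF m t] by (intro frac_le) auto
        then show ?thesis
          using c \<open>c \<le> \<pi> m t\<close> by (simp add: diff_divide_distrib)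
      qed
      then have "(\<epsilon> m)\<^sup>2 * (1 / \<pi> m t - 1) \<le> (\<epsilon> m)\<^sup>2 * (real m powr (- q) / c)"
        if "t \<in> {1..m}" for t
        using that by (intro mult_left_mono) auto
      then have "1 + (\<epsilon> m)\<^sup>2 * (1 / \<pi> m t - 1) \<le> exp ((\<epsilon> m)\<^sup>2 * (real m powr (- q) / c))"
        if "t \<in> {1..m}" for t
        using that exp_ge_add_one_self[of "(\<epsilon> m)\<^sup>2 * (real m powr (- q) / c)"]
        by (meson add_left_mono order_trans)
      moreover have "0 \<le> 1 + (\<epsilon> m)\<^sup>2 * (1 / \<pi> m t - 1)" if "t \<in> {1..m}" for t
        using pi[OF that] by (intro add_nonneg_nonneg mult_nonneg_nonneg) auto
      ultimately have "(\<Prod>t=1..m. 1 + (\<epsilon> m)\<^sup>2 * (1 / \<pi> m t - 1)) \<le>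
          (\<Prod>t=1..m. exp ((\<epsilon> m)\<^sup>2 * (real m powr (- q) / c)))"
        by (intro prod_mono) auto
      also have "\<dots> = exp (real m powr (1 - (q + 2 * p)) / c)"
        by (simp add: exp_of_nat_mult[symmetric] rate[OF m, symmetric])
      finally show ?thesis
        using total_variation_distance_bound by (smt (verit) real_sqrt_le_mono)
    qed
    \<comment> \<open>Comparison with the empty event.\<close>
    have TV0: "0 \<le> ?TV m" if m: "m \<ge> 2" for m
    proof -
      interpret mixture_detection "\<epsilon> m" "\<pi> m" m by (rule mix[OF m])
      show ?thesis
        using total_variation_distance_ge[OF H0.prob_space_axioms H1.prob_space_axioms sets.empty_sets]
        by simp
    qed
    have TV: "?TV \<longlonglongrightarrow> 0"
    proof (rule tendsto_sandwich)
      show "\<forall>\<^sub>F m in sequentially. 0 \<le> ?TV m"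
        using TV0 by (rule eventually_at_top_linorderI)
      show "\<forall>\<^sub>F m in sequentially. ?TV m \<le> sqrt (exp (real m powr (1 - (q + 2 * p)) / c) - 1)"
        using bound by (rule eventually_at_top_linorderI)
      show "(\<lambda>m. sqrt (exp (real m powr (1 - (q + 2 * p)) / c) - 1)) \<longlonglongrightarrow> 0"
        using r c by real_asymp
    qed simp
    then show "merge_asymptotically H0_law (\<lambda>m. H1_mix_law (\<epsilon> m) (\<pi> m) m)"
      by (simp add: merge_asymptotically_def)
    show "\<forall>\<phi>. (\<forall>m\<ge>2. is_test m (\<phi> m)) \<longrightarrow> ?err \<phi> \<longlonglongrightarrow> 1 \<and> \<not> ?err \<phi> \<longlonglongrightarrow> 0"
    proof (intro allI impI)
      fix \<phi> :: "nat \<Rightarrow> (nat \<Rightarrow> real) \<Rightarrow> bool"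
      assume test: "\<forall>m\<ge>2. is_test m (\<phi> m)"
      \<comment> \<open>The bound holds from m = 2 on, exactly where the tests are assumed
        measurable, and this suffices for the limit.\<close>
      have "norm (?err \<phi> m - 1) \<le> ?TV m" if m: "m \<ge> 2" for m
        using mixture_detection.abs_test_errors_minus_1_le[OF mix[OF m]] test m by simp
      then have "(\<lambda>m. ?err \<phi> m - 1) \<longlonglongrightarrow> 0"
        by (intro Lim_null_comparison[OF _ TV] eventually_at_top_linorderI[of 2])
      then have "?err \<phi> \<longlonglongrightarrow> 1"
        by (rule LIM_zero_cancel)
      then show "?err \<phi> \<longlonglongrightarrow> 1 \<and> \<not> ?err \<phi> \<longlonglongrightarrow> 0"
        using LIMSEQ_unique by fastforce
    qed
  }
qed

end
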